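(* Let $p\in\{0,1,2,\dots\}\cup\{\infty\}$. For every $f\in A(D)$ the following equivalence holds: $f\in A^p(D)$ if and only if the map $g:\mathbb{R}\to\mathbb{C}$ defined by $g(t)=f(e^{it})$ is in $C^p(\mathbb{T})$. In that case, if $p\ge 1$, then for all $t\in\mathbb{R}$ $$\frac{dg}{dt}(t)=ie^{it}f'(e^{it}),$$ where $f'(e^{it})$ denotes the value at $e^{it}$ of the continuous extension of $f'$ to $\overline{D}$.
   Context: $D$ is the open unit disk in $\mathbb{C}$ and $\mathbb{T}=\partial D$ is the unit circle. $A(D)$ is the set of functions $f:\overline{D}\to\mathbb{C}$ that are continuous on $\overline{D}$ and holomorphic in $D$. $A^p(D)$ is the set of holomorphic functions on $D$ whose derivatives $f^{(l)}$ of every order $l\in\{0,1,2,\dots\}$ with $l\le p$ extend continuously to $\overline{D}$. A $2\pi$-periodic function $g:\mathbb{R}\to\mathbb{C}$ is said to be in $C^p(\mathbb{T})$ if it is of class $C^p$ on $\mathbb{R}$ as a function of the real variable $t$. *)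

theory Defs
  imports "HOL-Complex_Analysis.Complex_Analysis" "HOL-Library.Extended_Nat"
begin

definition disc_algebra :: "(complex \<Rightarrow> complex) set"
  where "disc_algebra = {f. continuous_on (cball 0 1) f \<and> f holomorphic_on ball 0 1}"

text \<open>Such an \<open>F\<close> is unique on the closed disc, since the open disc is dense in it;
  its values outside the closed disc are irrelevant.\<close>

definition cont_extension_to_cdisc :: "(complex \<Rightarrow> complex) \<Rightarrow> (complex \<Rightarrow> complex) \<Rightarrow> bool"
  where "cont_extension_to_cdisc h F \<longleftrightarrow>
    continuous_on (cball 0 1) F \<and> (\<forall>z\<in>ball 0 1. F z = h z)"

text \<open>Only the values on the open disc matter: a total function is in \<open>A_space p\<close> iff its
  restriction to the open disc is in $A^p(D)$.\<close>

definition A_space :: "enat \<Rightarrow> (complex \<Rightarrow> complex) set"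
  where "A_space p = {f. f holomorphic_on ball 0 1 \<and>
    (\<forall>l::nat. enat l \<le> p \<longrightarrow> (\<exists>F. cont_extension_to_cdisc ((deriv ^^ l) f) F))}"

definition real_deriv :: "(real \<Rightarrow> complex) \<Rightarrow> real \<Rightarrow> complex"
  where "real_deriv g = (\<lambda>t. vector_derivative g (at t))"

text \<open>The derivative operator is total, so differentiability of the derivatives of order
  below \<open>p\<close> is required explicitly.\<close>

definition of_class_C :: "enat \<Rightarrow> (real \<Rightarrow> complex) \<Rightarrow> bool"
  where "of_class_C p g \<longleftrightarrow>
    (\<forall>l::nat. enat l < p \<longrightarrow> (\<forall>t. (real_deriv ^^ l) g differentiable (at t))) \<and>
    (\<forall>l::nat. enat l \<le> p \<longrightarrow> continuous_on UNIV ((real_deriv ^^ l) g))"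

definition C_circle :: "enat \<Rightarrow> (real \<Rightarrow> complex) set"
  where "C_circle p = {g. (\<forall>t. g (t + 2 * pi) = g t) \<and> of_class_C p g}"

end

theory Submission
  imports Defs
begin

text \<open>
  If \<open>f'\<close> extends to \<open>F\<close>, the dilations \<open>z \<mapsto> f (r z)\<close> show that \<open>f\<close> has complex derivative \<open>F z\<close>
  relative to the closed disc at every point, and the chain rule gives the formula for \<open>g'\<close>.
  Conversely, let \<open>g\<close> be \<open>C\<^sup>1\<close>. The rotation quotients \<open>(f (e\<^sup>i\<^sup>s z) - f z) / s\<close> converge uniformly on
  the circle to \<open>g'\<close> as \<open>s \<rightarrow> 0\<close>, hence, by the maximum principle, uniformly on the closed disc;
  inside the disc their limit is \<open>i z f' z\<close>. So \<open>i z f' z\<close> extends continuously, and so does \<open>f'\<close>.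
  Higher orders follow by induction, because \<open>F\<close> and \<open>i z F z\<close> have the same smoothness.
\<close>

section \<open>Continuous extension to the closed disc\<close>

abbreviation extendable :: "(complex \<Rightarrow> complex) \<Rightarrow> bool"
  where "extendable h \<equiv> \<exists>F. cont_extension_to_cdisc h F"

lemma extendable_cong:
  assumes "\<And>z. z \<in> ball 0 1 \<Longrightarrow> h z = k z"
  shows "extendable h \<longleftrightarrow> extendable k"
  using assms by (auto simp: cont_extension_to_cdisc_def)

lemma extendable_mult:
  assumes "continuous_on (cball 0 1) c" "extendable h"
  shows "extendable (\<lambda>z. c z * h z)"
proof -
  obtain F where "continuous_on (cball 0 1) F" "\<forall>z\<in>ball 0 1. F z = h z"
    using assms(2) by (auto simp: cont_extension_to_cdisc_def)
  then show ?thesis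
    using assms(1) by (intro exI[of _ "\<lambda>z. c z * F z"])
      (auto simp: cont_extension_to_cdisc_def intro!: continuous_intros)
qed

lemma extendable_add:
  assumes "extendable h" "extendable k"
  shows "extendable (\<lambda>z. h z + k z)"
proof -
  obtain F G where "continuous_on (cball 0 1) F" "\<forall>z\<in>ball 0 1. F z = h z"
    "continuous_on (cball 0 1) G" "\<forall>z\<in>ball 0 1. G z = k z"
    using assms by (auto simp: cont_extension_to_cdisc_def)
  then show ?thesis
    by (intro exI[of _ "\<lambda>z. F z + G z"])
      (auto simp: cont_extension_to_cdisc_def intro!: continuous_intros)
qed

text \<open>Away from the origin the extension of \<open>\<i> * z * h z\<close> can be divided by
  \<open>\<i> * z\<close>. At the origin this quotient is useless, and the continuity of
  \<open>h\<close> in the open disc takes over.\<close>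

lemma extendable_divide_id:
  assumes "continuous_on (ball 0 1) h" and "extendable (\<lambda>z. \<i> * z * h z)"
  shows "extendable h"
proof -
  obtain H where H: "continuous_on (cball 0 1) H" "\<forall>z\<in>ball 0 1. H z = \<i> * z * h z"
    using assms(2) by (auto simp: cont_extension_to_cdisc_def)
  define F where "F = (\<lambda>z. if z \<in> ball 0 1 then h z else H z / (\<i> * z))"
  have eq: "F z = H z / (\<i> * z)" if "z \<noteq> 0" for z
    using H(2) that by (auto simp: F_def)
  have "continuous (at z within cball 0 1) F" if z: "z \<in> cball 0 1" for z
  proof (cases "z = 0")
    case True
    have "continuous_on (ball 0 1) F"
      using assms(1) by (rule continuous_on_eq) (auto simp: F_def)
    then have "isCont F z"
      using True continuous_on_eq_continuous_at[OF open_ball, of 0 1 F] by simp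
    then show ?thesis
      by (rule continuous_at_imp_continuous_at_within)
  next
    case False
    have "continuous (at z within cball 0 1) (\<lambda>z. H z / (\<i> * z))"
      using H(1) z False by (auto intro!: continuous_intros simp: continuous_on_eq_continuous_within)
    \<comment> \<open>The radius \<open>norm z\<close> keeps the origin out of the neighbourhood, so
      there \<open>F\<close> is the quotient throughout, across the circle as well.\<close>
    moreover have "H x / (\<i> * x) = F x" if "dist x z < norm z" for x
    proof -
      have "x \<noteq> 0"
        using that by auto
      then show ?thesis
        by (rule eq[symmetric])
    qed
    ultimately show ?thesis
      using continuous_transform_within[of z "cball 0 1" "\<lambda>z. H z / (\<i> * z)" "norm z" F] z False
      by simp
  qed
  then have "continuous_on (cball 0 1) F"
    by (simp add: continuous_on_eq_continuous_within)
  then show ?thesis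
    by (auto simp: cont_extension_to_cdisc_def F_def)
qed

section \<open>Multiplication by \<open>\<i> * z\<close> and higher derivatives\<close>

text \<open>The Leibniz rule, which stops after two terms because the factor \<open>\<i> * z\<close>
  is linear. Writing the order as \<open>Suc l\<close> avoids a predecessor in the second
  term.\<close>

lemma higher_deriv_ident_mult:
  assumes "F holomorphic_on S" "open S" "z \<in> S"
  shows "(deriv ^^ Suc l) (\<lambda>z. \<i> * z * F z) z
    = \<i> * z * (deriv ^^ Suc l) F z + (\<i> * of_nat (Suc l)) * (deriv ^^ l) F z"
  using assms(3)
proof (induction l arbitrary: z)
  case 0
  have "(F has_field_derivative deriv F z) (at z)"
    using assms 0 holomorphic_derivI by blast
  then have "((\<lambda>z. \<i> * z * F z) has_field_derivative \<i> * z * deriv F z + \<i> * F z) (at z)"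
    by (auto intro!: derivative_eq_intros simp: algebra_simps)
  then show ?case
    by (simp add: DERIV_imp_deriv)
next
  case (Suc l)
  have hol: "(deriv ^^ k) F holomorphic_on S" for k
    using assms by (intro holomorphic_higher_deriv)
  have d: "((deriv ^^ k) F has_field_derivative (deriv ^^ Suc k) F z) (at z)" for k
    using holomorphic_derivI[OF hol assms(2) Suc.prems] by simp
  have "((\<lambda>z. \<i> * z * (deriv ^^ Suc l) F z + (\<i> * of_nat (Suc l)) * (deriv ^^ l) F z)
     has_field_derivative \<i> * z * (deriv ^^ Suc (Suc l)) F z
       + (\<i> * of_nat (Suc (Suc l))) * (deriv ^^ Suc l) F z) (at z)"
    by (rule derivative_eq_intros d refl)+ (simp add: algebra_simps)
  then have "((deriv ^^ Suc l) (\<lambda>z. \<i> * z * F z)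
     has_field_derivative \<i> * z * (deriv ^^ Suc (Suc l)) F z
       + (\<i> * of_nat (Suc (Suc l))) * (deriv ^^ Suc l) F z) (at z)"
    by (rule has_field_derivative_transform_within_open[OF _ assms(2) Suc.prems])
      (use Suc.IH in simp)
  then show ?case
    by (simp add: DERIV_imp_deriv)
qed

text \<open>By the Leibniz rule, each derivative of the product combines two consecutive derivatives
  of \<open>F\<close>. Conversely, once the lower order is known to extend, the top term can be
  isolated and divided by \<open>\<i> * z\<close>.\<close>

lemma A_space_ident_mult_iff:
  assumes hol: "F holomorphic_on ball 0 1"
  shows "(\<lambda>z. \<i> * z * F z) \<in> A_space p \<longleftrightarrow> F \<in> A_space p"
proof -
  let ?h = "\<lambda>z. \<i> * z * F z"
  have holh: "?h holomorphic_on ball 0 1"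
    by (intro holomorphic_intros hol)
  have dF: "(deriv ^^ l) F holomorphic_on ball 0 1" for l
    by (intro holomorphic_higher_deriv hol open_ball)
  have cont: "continuous_on (ball 0 1) ((deriv ^^ l) F)" for l
    using dF by (rule holomorphic_on_imp_continuous_on)
  have eq: "extendable ((deriv ^^ Suc l) ?h) \<longleftrightarrow>
    extendable (\<lambda>z. \<i> * z * (deriv ^^ Suc l) F z + (\<i> * of_nat (Suc l)) * (deriv ^^ l) F z)" for l
    by (rule extendable_cong) (rule higher_deriv_ident_mult[OF hol open_ball])
  have 1: "extendable ((deriv ^^ l) ?h)" if F: "\<And>k. k \<le> l \<Longrightarrow> extendable ((deriv ^^ k) F)" for l
  proof (cases l)
    case 0
    then show ?thesis
      using extendable_mult[of "\<lambda>z. \<i> * z"] F[of 0] by (auto intro: continuous_intros)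
  next
    case (Suc m)
    show ?thesis
      unfolding Suc eq using Suc
      by (intro extendable_add extendable_mult F) (auto intro!: continuous_intros)
  qed
  have 2: "extendable ((deriv ^^ l) F)" if "\<And>k. k \<le> l \<Longrightarrow> extendable ((deriv ^^ k) ?h)" for l
    using that
  proof (induction l)
    case 0
    then show ?case
      using extendable_divide_id[of F] cont[of 0] by auto
  next
    case (Suc l)
    \<comment> \<open>The added summand cancels the lower Leibniz term and leaves only the
      derivative of order \<open>Suc l\<close> times \<open>\<i> * z\<close>.\<close>
    have "extendable (\<lambda>z. (\<i> * z * (deriv ^^ Suc l) F z + (\<i> * of_nat (Suc l)) * (deriv ^^ l) F z)
        + (- \<i> * of_nat (Suc l)) * (deriv ^^ l) F z)"
    proof (rule extendable_add[OF _ extendable_mult[OF continuous_on_const]])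
      show "extendable (\<lambda>z. \<i> * z * (deriv ^^ Suc l) F z + (\<i> * of_nat (Suc l)) * (deriv ^^ l) F z)"
        using Suc.prems[of "Suc l"] eq[of l] by simp
      show "extendable ((deriv ^^ l) F)"
        by (rule Suc.IH, rule Suc.prems, rule le_SucI)
    qed
    then have "extendable (\<lambda>z. \<i> * z * (deriv ^^ Suc l) F z)"
      by (simp add: algebra_simps)
    then show ?case
      by (rule extendable_divide_id[OF cont])
  qed
  have le: "enat k \<le> p" if "enat l \<le> p" "k \<le> l" for k l
    using that by (meson enat_ord_simps(1) order_trans)
  show ?thesis
    unfolding A_space_def mem_Collect_eq
  proof (intro conj_cong allI iffI impI)
    fix l
    assume "\<forall>l. enat l \<le> p \<longrightarrow> extendable ((deriv ^^ l) ?h)" "enat l \<le> p"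
    then show "extendable ((deriv ^^ l) F)"
      by (intro 2) (blast intro: le)
  next
    fix l
    assume "\<forall>l. enat l \<le> p \<longrightarrow> extendable ((deriv ^^ l) F)" "enat l \<le> p"
    then show "extendable ((deriv ^^ l) ?h)"
      by (intro 1) (blast intro: le)
  qed (use hol holh in auto)
qed

section \<open>Reduction to finite orders and recursion on the order\<close>

lemma A_space_iff_enat: "f \<in> A_space p \<longleftrightarrow> (\<forall>n. enat n \<le> p \<longrightarrow> f \<in> A_space (enat n))"
proof -
  have "enat 0 \<le> p"
    by (simp flip: zero_enat_def)
  moreover have "enat l \<le> p" if "enat n \<le> p" "l \<le> n" for l n
    using that by (meson enat_ord_simps(1) order_trans)
  ultimately show ?thesis
    by (auto simp: A_space_def)
qed

lemma of_class_C_iff_enat: "of_class_C p g \<longleftrightarrow> (\<forall>n. enat n \<le> p \<longrightarrow> of_class_C (enat n) g)"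
  (is "?L \<longleftrightarrow> ?R")
proof
  assume ?L
  then show ?R
    unfolding of_class_C_def by (meson order_trans less_le_trans)
next
  assume R: ?R
  \<comment> \<open>Differentiability is demanded only strictly below the order, so at
    \<open>l\<close> it is read off from class \<open>enat (Suc l)\<close>.\<close>
  have "(real_deriv ^^ l) g differentiable (at t)" if "enat l < p" for l t
  proof -
    have "enat (Suc l) \<le> p"
      using that by (metis Suc_ile_eq)
    then have "of_class_C (enat (Suc l)) g"
      using R by blast
    then show ?thesis
      by (simp add: of_class_C_def)
  qed
  then show ?L
    using R by (auto simp: of_class_C_def)
qed

text \<open>Shifting the index by one turns every clause for \<open>g\<close> of positive order into
  a clause for \<open>real_deriv g\<close>. The continuity clause of order zero follows from
  differentiability.\<close>

lemma of_class_C_Suc: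
  "of_class_C (enat (Suc n)) g \<longleftrightarrow>
    (\<forall>t. g differentiable (at t)) \<and> of_class_C (enat n) (real_deriv g)"
proof -
  have cont: "continuous_on UNIV g" if "\<forall>t. g differentiable (at t)"
    using that by (simp add: continuous_on_eq_continuous_at differentiable_imp_continuous_within)
  have All_less: "(\<forall>l<Suc n. P l) \<longleftrightarrow> P 0 \<and> (\<forall>l<n. P (Suc l))" for P :: "nat \<Rightarrow> bool"
    by (rule All_less_Suc2)
  have All_le: "(\<forall>l\<le>Suc n. P l) \<longleftrightarrow> P 0 \<and> (\<forall>l\<le>n. P (Suc l))" for P :: "nat \<Rightarrow> bool"
    by (simp add: All_less_Suc2 flip: less_Suc_eq_le)
  show ?thesis
    unfolding of_class_C_def enat_ord_simps All_less All_le funpow_Suc_right o_def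
    using cont by auto
qed

text \<open>The counterpart of \<open>of_class_C_Suc\<close>. The extension \<open>F\<close> equals
  \<open>deriv f\<close> on an open set, so all their derivatives agree there; recording
  \<open>F \<in> disc_algebra\<close> makes \<open>F\<close> available to an induction.\<close>

lemma A_space_Suc:
  assumes "f \<in> disc_algebra"
  shows "f \<in> A_space (enat (Suc n)) \<longleftrightarrow>
    (\<exists>F. cont_extension_to_cdisc (deriv f) F \<and> F \<in> disc_algebra \<and> F \<in> A_space (enat n))"
proof -
  have hol: "f holomorphic_on ball 0 1" and f: "extendable f"
    using assms by (auto simp: disc_algebra_def cont_extension_to_cdisc_def)
  have hol': "deriv f holomorphic_on ball 0 1"
    using hol by (intro holomorphic_deriv) auto
  have ext: "F \<in> disc_algebra \<and> (F \<in> A_space (enat n) \<longleftrightarrow> (\<forall>l\<le>n. extendable ((deriv ^^ Suc l) f)))"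
    if F: "cont_extension_to_cdisc (deriv f) F" for F
  proof -
    have eq: "F z = deriv f z" if "z \<in> ball 0 1" for z
      using F that by (auto simp: cont_extension_to_cdisc_def)
    have holF: "F holomorphic_on ball 0 1"
      by (rule holomorphic_transform[OF hol']) (simp add: eq)
    have "extendable ((deriv ^^ l) F) \<longleftrightarrow> extendable ((deriv ^^ Suc l) f)" for l
      unfolding funpow_Suc_right o_def
      by (rule extendable_cong)
        (rule higher_deriv_transform_within_open[OF holF hol' open_ball _ eq])
    then show ?thesis
      using F holF by (auto simp: disc_algebra_def A_space_def cont_extension_to_cdisc_def)
  qed
  have "f \<in> A_space (enat (Suc n)) \<longleftrightarrow> (\<forall>l\<le>n. extendable ((deriv ^^ Suc l) f))"
    unfolding A_space_def mem_Collect_eq enat_ord_simps using hol f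
    by (simp add: All_less_Suc2 flip: less_Suc_eq_le del: funpow.simps(2))
  moreover have "extendable (deriv f)" if "\<forall>l\<le>n. extendable ((deriv ^^ Suc l) f)"
    using that[rule_format, of 0] by simp
  ultimately show ?thesis
    using ext by blast
qed

section \<open>Complex derivative up to the boundary\<close>

text \<open>Each dilation of \<open>f\<close> is differentiable at every point of the closed disc,
  the circle included. The dilated derivatives converge uniformly to \<open>F\<close>, so
  differentiation passes to the limit on the convex set \<open>cball 0 1\<close>.\<close>

lemma has_field_derivative_within_cdisc:
  assumes f: "f \<in> disc_algebra" and F: "cont_extension_to_cdisc (deriv f) F"
    and z: "z \<in> cball 0 1"
  shows "(f has_field_derivative F z) (at z within cball 0 1)"
proof -
  have contf: "continuous_on (cball 0 1) f" and holf: "f holomorphic_on ball 0 1"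
    using f by (auto simp: disc_algebra_def)
  have contF: "continuous_on (cball 0 1) F" and eqF: "\<And>z. z \<in> ball 0 1 \<Longrightarrow> F z = deriv f z"
    using F by (auto simp: cont_extension_to_cdisc_def)
  \<comment> \<open>The factors tend to 1 but stay strictly below it, which moves boundary points
    into the open disc.\<close>
  define a :: "nat \<Rightarrow> real" where "a = (\<lambda>n. 1 - inverse (real (Suc n)))"
  have a: "0 \<le> a n" "a n < 1" for n
    by (auto simp: a_def field_simps)
  have a_lim: "a \<longlonglongrightarrow> 1"
    unfolding a_def using tendsto_diff[OF tendsto_const LIMSEQ_inverse_real_of_nat, of 1] by simp
  have cball_mult: "of_real r * w \<in> cball 0 1" if "0 \<le> r" "r \<le> 1" "w \<in> cball 0 1"
    for r and w :: complex
    using that mult_mono[of r 1 "norm w" 1] by (auto simp: norm_mult)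
  have ball_mult: "of_real (a n) * w \<in> ball 0 1" if "w \<in> cball 0 1" for n and w :: complex
    using that a[of n] mult_left_le[of "norm w" "a n"] by (auto simp: norm_mult)
  define f' where "f' = (\<lambda>n w. of_real (a n) * F (of_real (a n) * w))"
  have "\<exists>G. \<forall>x \<in> cball 0 1. (\<lambda>n. f (of_real (a n) * x)) \<longlonglongrightarrow> G x \<and>
          (G has_field_derivative F x) (at x within cball 0 1)"
  proof (rule has_complex_derivative_sequence[where f' = f'])
    show "((\<lambda>x. f (of_real (a n) * x)) has_field_derivative f' n x) (at x within cball 0 1)"
      if "x \<in> cball 0 1" for n x
    proof -
      have "(f has_field_derivative F (of_real (a n) * x)) (at (of_real (a n) * x))"
        using holomorphic_derivI[OF holf open_ball ball_mult[OF that]] eqF[OF ball_mult[OF that]]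
        by simp
      then have "((\<lambda>x. f (of_real (a n) * x)) has_field_derivative
          F (of_real (a n) * x) * of_real (a n)) (at x within cball 0 1)"
        by (rule DERIV_chain2) (auto intro!: derivative_eq_intros)
      then show ?thesis
        by (simp add: f'_def mult.commute)
    qed
  next
    fix e :: real
    assume e: "e > 0"
    let ?K = "{0..1::real} \<times> cball (0::complex) 1"
    \<comment> \<open>The first slot is the dilation factor: \<open>a n\<close> gives
      \<open>f' n\<close> and 1 gives \<open>F\<close>. Uniform continuity on a compact product
      makes the comparison uniform in the point.\<close>
    let ?\<phi> = "\<lambda>p. of_real (fst p) * F (of_real (fst p) * snd p)"
    have "continuous_on ?K ?\<phi>"
      by (intro continuous_intros continuous_on_compose2[OF contF]) (use cball_mult in auto)
    then have "uniformly_continuous_on ?K ?\<phi>"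
      by (intro compact_uniformly_continuous compact_Times) auto
    then obtain d where d: "d > 0"
      "\<And>p q. p \<in> ?K \<Longrightarrow> q \<in> ?K \<Longrightarrow> dist p q < d \<Longrightarrow> dist (?\<phi> p) (?\<phi> q) < e"
      unfolding uniformly_continuous_on_def using e by metis
    obtain N where N: "\<And>n. n \<ge> N \<Longrightarrow> dist (a n) 1 < d"
      using a_lim d(1) by (auto simp: lim_sequentially)
    have "norm (f' n x - F x) \<le> e" if "n \<ge> N" "x \<in> cball 0 1" for n x
    proof -
      have "dist (?\<phi> (a n, x)) (?\<phi> (1, x)) < e"
        using a[of n] that N[OF that(1)] by (intro d(2)) (auto simp: dist_Pair_Pair)
      then show ?thesis
        by (simp add: f'_def dist_norm)
    qed
    then show "\<exists>N. \<forall>n x. n \<ge> N \<longrightarrow> x \<in> cball 0 1 \<longrightarrow> norm (f' n x - F x) \<le> e"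
      by blast
  next
    show "\<exists>x l. x \<in> cball 0 1 \<and> (\<lambda>n. f (of_real (a n) * x)) \<longlonglongrightarrow> l"
      by (intro exI[of _ 0] exI[of _ "f 0"]) auto
  qed auto
  then obtain G where G: "\<And>x. x \<in> cball 0 1 \<Longrightarrow> (\<lambda>n. f (of_real (a n) * x)) \<longlonglongrightarrow> G x"
    "\<And>x. x \<in> cball 0 1 \<Longrightarrow> (G has_field_derivative F x) (at x within cball 0 1)"
    by blast
  \<comment> \<open>The limit theorem only yields some limit \<open>G\<close>; continuity of
    \<open>f\<close> up to the circle identifies it.\<close>
  have "G x = f x" if x: "x \<in> cball 0 1" for x
  proof -
    have "(\<lambda>n. of_real (a n) * x) \<longlonglongrightarrow> of_real 1 * x"
      by (intro tendsto_intros a_lim)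
    then have "(\<lambda>n. f (of_real (a n) * x)) \<longlonglongrightarrow> f x"
      using x ball_mult[OF x]
      by (intro continuous_on_tendsto_compose[OF contf]) (auto intro!: always_eventually less_imp_le)
    then show ?thesis
      using G(1)[OF x] LIMSEQ_unique by blast
  qed
  then show ?thesis
    using has_field_derivative_transform_within[OF G(2)[OF z] zero_less_one z] by blast
qed

lemma circle_in_cball: "exp (\<i> * complex_of_real t) \<in> cball 0 1"
  by (simp add: norm_exp_i_times)

text \<open>At a boundary point \<open>f\<close> is known to be differentiable only relative to the
  closed disc. This suffices for the chain rule, since the curve never leaves the circle.\<close>

lemma has_vector_derivative_boundary:
  assumes "f \<in> disc_algebra" and "cont_extension_to_cdisc (deriv f) F"
  shows "((\<lambda>t. f (exp (\<i> * complex_of_real t))) has_vector_derivative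
    \<i> * exp (\<i> * complex_of_real t) * F (exp (\<i> * complex_of_real t))) (at t)"
proof -
  let ?e = "\<lambda>t. exp (\<i> * complex_of_real t)"
  have e: "(?e has_vector_derivative \<i> * ?e t) (at t)"
    by (rule has_vector_derivative_real_field[of "\<lambda>z. exp (\<i> * z)"])
      (auto intro!: derivative_eq_intros)
  have "(f has_field_derivative F (?e t)) (at (?e t) within range ?e)"
    using has_field_derivative_within_cdisc[OF assms circle_in_cball]
    by (rule has_field_derivative_subset) (use circle_in_cball in auto)
  from field_vector_diff_chain_within[OF e this] show ?thesis
    by (simp add: o_def)
qed

section \<open>From smooth boundary values to an extension of the derivative\<close>

lemma extendable_deriv_if_C1_boundary:
  fixes f :: "complex \<Rightarrow> complex"
  defines "g \<equiv> \<lambda>t. f (exp (\<i> * complex_of_real t))"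
  assumes f: "f \<in> disc_algebra" and diff: "\<And>t. g differentiable (at t)"
    and cont: "continuous_on UNIV (real_deriv g)"
  shows "extendable (deriv f)"
proof -
  let ?e = "\<lambda>t. exp (\<i> * complex_of_real t)"
  let ?g' = "real_deriv g"
  have contf: "continuous_on (cball 0 1) f" and holf: "f holomorphic_on ball 0 1"
    using f by (auto simp: disc_algebra_def)
  define s :: "nat \<Rightarrow> real" where "s = (\<lambda>n. inverse (real (Suc n)))"
  have s: "0 < s n" "s n \<le> 1" for n
    by (auto simp: s_def field_simps)
  have s_lim: "s \<longlonglongrightarrow> 0"
    unfolding s_def by (rule LIMSEQ_inverse_real_of_nat)
  \<comment> \<open>Rotation by \<open>s n\<close> translates the parameter on the circle, so there
    \<open>D n\<close> is the difference quotient of \<open>g\<close> with step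
    \<open>s n\<close>.\<close>
  define D where "D = (\<lambda>n z. (f (?e (s n) * z) - f z) / of_real (s n))"
  have contD: "continuous_on (cball 0 1) (D n)" for n
    unfolding D_def
    by (intro continuous_intros continuous_on_compose2[OF contf])
      (use s[of n] in \<open>auto simp: norm_mult\<close>)
  have holD: "D n holomorphic_on ball 0 1" for n
    unfolding D_def
    by (intro holomorphic_intros holf holomorphic_on_compose_gen[OF _ holf, unfolded o_def])
      (use s[of n] in \<open>auto simp: norm_mult\<close>)
  have boundary: "\<exists>N. \<forall>n\<ge>N. \<forall>t\<in>{0..2*pi}. norm (D n (?e t) - ?g' t) \<le> e" if "e > 0" for e
  proof -
    \<comment> \<open>One unit beyond a full period, because \<open>t + s n\<close> with
      \<open>s n \<le> 1\<close> has to remain in the interval.\<close>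
    let ?K = "{0..2 * pi + 1}"
    have "uniformly_continuous_on ?K ?g'"
      using cont by (intro compact_uniformly_continuous) (auto intro: continuous_on_subset)
    then obtain d where d: "d > 0"
      "\<And>t u. t \<in> ?K \<Longrightarrow> u \<in> ?K \<Longrightarrow> dist u t < d \<Longrightarrow> dist (?g' u) (?g' t) < e"
      unfolding uniformly_continuous_on_def using \<open>e > 0\<close> by metis
    obtain N where N: "\<And>n. n \<ge> N \<Longrightarrow> dist (s n) 0 < d"
      using s_lim d(1) by (auto simp: lim_sequentially)
    have "norm (D n (?e t) - ?g' t) \<le> e" if n: "n \<ge> N" and t: "t \<in> {0..2*pi}" for n t
    proof -
      have der: "(g has_vector_derivative ?g' u) (at u within {t..t + s n})" for u
        using diff[of u] by (auto simp: real_deriv_def vector_derivative_works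
          intro: has_vector_derivative_at_within)
      have "norm (g (t + s n) - g t - ((t + s n) - t) *\<^sub>R ?g' t) \<le> norm ((t + s n) - t) * e"
      \<comment> \<open>Mean value inequality: the linearization error is at most the step times the
        oscillation of \<open>?g'\<close> over it.\<close>
      proof (rule vector_differentiable_bound_linearization[OF der])
        show "norm (?g' x - ?g' t) \<le> e" if "x \<in> {t..t + s n}" for x
        proof -
          have "dist x t < d" "x \<in> ?K" "t \<in> ?K"
            using that t N[OF n] s[of n] by (auto simp: dist_real_def)
          then show ?thesis
            using d(2)[of t x] by (simp add: dist_norm)
        qed
      qed (use s[of n] in \<open>auto simp: closed_segment_eq_real_ivl\<close>)
      then have *: "norm (g (t + s n) - g t - s n *\<^sub>R ?g' t) \<le> s n * e"
        using s[of n] by simp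
      have "g (t + s n) = f (?e (s n) * ?e t)"
        by (simp add: g_def ring_distribs exp_add mult.commute)
      then have "D n (?e t) - ?g' t = (g (t + s n) - g t - s n *\<^sub>R ?g' t) / of_real (s n)"
        using s[of n] by (simp add: D_def g_def field_simps scaleR_conv_of_real)
      then show ?thesis
        using * s[of n] by (simp only: norm_divide) (simp add: pos_divide_le_eq mult.commute)
    qed
    then show ?thesis
      by blast
  qed
  \<comment> \<open>The boundary limit \<open>?g'\<close> has no counterpart inside the disc yet.
    Differences \<open>D m - D n\<close> do live on the whole disc, and the maximum principle
    carries their boundary bound inwards.\<close>
  have "uniformly_Cauchy_on (cball 0 1) D"
  proof (rule uniformly_Cauchy_onI)
    fix e :: real
    assume "e > 0"
    \<comment> \<open>Two boundary errors add up to \<open>2 * e / 3\<close>, leaving room for the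
      strict bound by \<open>e\<close>.\<close>
    then have "e / 3 > 0"
      by simp
    from boundary[OF this] obtain N
      where N: "\<And>n t. n \<ge> N \<Longrightarrow> t \<in> {0..2*pi} \<Longrightarrow> norm (D n (?e t) - ?g' t) \<le> e / 3"
      by blast
    have "dist (D m z) (D n z) < e" if mn: "m \<ge> N" "n \<ge> N" and z: "z \<in> cball 0 1" for m n z
    proof -
      have "norm (D m z - D n z) \<le> 2 * e / 3"
      proof (rule maximum_modulus_frontier[of "\<lambda>z. D m z - D n z" "cball 0 1"])
        fix w :: complex
        assume "w \<in> frontier (cball 0 1)"
        then have "norm w = 1"
          by (simp add: frontier_cball)
        then obtain t where t: "0 \<le> t" "t < 2 * pi" "w = ?e t"
          using complex_unimodular_polar[of w] by (auto simp: cis_conv_exp simp flip: cis.code)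
        have "norm (D m w - D n w) \<le> norm (D m w - ?g' t) + norm (D n w - ?g' t)"
          using norm_triangle_ineq4[of "D m w - ?g' t" "D n w - ?g' t"] by simp
        also have "\<dots> \<le> 2 * e / 3"
          using N[OF mn(1), of t] N[OF mn(2), of t] t by simp
        finally show "norm (D m w - D n w) \<le> 2 * e / 3" .
      qed (use z in \<open>auto intro!: holomorphic_intros continuous_intros holD contD\<close>)
      then show ?thesis
        using \<open>e > 0\<close> by (simp add: dist_norm)
    qed
    then show "\<exists>M. \<forall>x\<in>cball 0 1. \<forall>m\<ge>M. \<forall>n\<ge>M. dist (D m x) (D n x) < e"
      by blast
  qed
  then obtain L where L: "uniform_limit (cball 0 1) D L sequentially"
    using Cauchy_uniformly_convergent uniformly_convergent_on_def by blast
  have contL: "continuous_on (cball 0 1) L"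
    using L by (rule uniform_limit_theorem[rotated]) (auto simp: contD)
  have "L z = \<i> * z * deriv f z" if z: "z \<in> ball 0 1" for z
  proof -
    \<comment> \<open>With the rotation angle as a complex variable, \<open>D n z\<close> is the
      difference quotient of \<open>?\<phi>\<close> at 0 with increment \<open>s n\<close>.\<close>
    let ?\<phi> = "\<lambda>w. f (exp (\<i> * w) * z)"
    have "(f has_field_derivative deriv f z) (at (exp (\<i> * 0) * z))"
      using holomorphic_derivI[OF holf open_ball z] by simp
    then have "(?\<phi> has_field_derivative deriv f z * (\<i> * z)) (at 0)"
      by (rule DERIV_chain2) (auto intro!: derivative_eq_intros)
    then have lim: "((\<lambda>w. (?\<phi> w - ?\<phi> 0) / (w - 0)) \<longlongrightarrow> deriv f z * (\<i> * z)) (at 0)"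
      by (simp only: has_field_derivative_iff)
    have "(\<lambda>n. complex_of_real (s n)) \<longlonglongrightarrow> of_real 0"
      by (intro tendsto_intros s_lim)
    then have "filterlim (\<lambda>n. complex_of_real (s n)) (at 0) sequentially"
      using s(1) by (auto simp: filterlim_at less_imp_neq[symmetric])
    from filterlim_compose[OF lim this] have "(\<lambda>n. D n z) \<longlonglongrightarrow> deriv f z * (\<i> * z)"
      by (simp add: D_def)
    moreover have "(\<lambda>n. D n z) \<longlonglongrightarrow> L z"
      using L z by (intro tendsto_uniform_limitI) auto
    ultimately show ?thesis
      using LIMSEQ_unique by (fastforce simp: mult_ac)
  qed
  then have "extendable (\<lambda>z. \<i> * z * deriv f z)"
    using contL by (auto simp: cont_extension_to_cdisc_def)
  moreover have "continuous_on (ball 0 1) (deriv f)"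
    by (intro holomorphic_on_imp_continuous_on holomorphic_deriv holf open_ball)
  ultimately show ?thesis
    by (rule extendable_divide_id[rotated])
qed

section \<open>Induction on the order and conclusion\<close>

text \<open>The induction varies \<open>f\<close>: the derivative of the boundary function of
  \<open>f\<close> is the boundary function of \<open>\<i> * z * F z\<close>, where \<open>F\<close>
  extends \<open>deriv f\<close>. The hypothesis applies to that product, and
  \<open>A_space_ident_mult_iff\<close> removes the factor.\<close>

lemma A_space_iff_of_class_C_enat:
  assumes "f \<in> disc_algebra"
  shows "f \<in> A_space (enat n) \<longleftrightarrow> of_class_C (enat n) (\<lambda>t. f (exp (\<i> * complex_of_real t)))"
  using assms
proof (induction n arbitrary: f)
  case 0
  then have "continuous_on UNIV (\<lambda>t. f (exp (\<i> * complex_of_real t)))"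
    by (intro continuous_on_compose2[of "cball 0 1" f UNIV "\<lambda>t. exp (\<i> * complex_of_real t)"])
      (auto simp: disc_algebra_def intro!: continuous_intros)
  with 0 show ?case
    by (auto simp: A_space_def of_class_C_def disc_algebra_def cont_extension_to_cdisc_def)
next
  case (Suc n)
  let ?g = "\<lambda>t. f (exp (\<i> * complex_of_real t))"
  have *: "(\<forall>t. ?g differentiable (at t)) \<and>
      (F \<in> A_space (enat n) \<longleftrightarrow> of_class_C (enat n) (real_deriv ?g))"
    if F: "cont_extension_to_cdisc (deriv f) F" and FA: "F \<in> disc_algebra" for F
  proof -
    let ?h = "\<lambda>z. \<i> * z * F z"
    have h: "?h \<in> disc_algebra"
      using FA by (auto simp: disc_algebra_def intro!: continuous_intros holomorphic_intros)
    note der = has_vector_derivative_boundary[OF Suc.prems F]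
    have "real_deriv ?g = (\<lambda>t. ?h (exp (\<i> * complex_of_real t)))"
      unfolding real_deriv_def by (rule ext) (rule vector_derivative_at[OF der])
    then have "of_class_C (enat n) (real_deriv ?g) \<longleftrightarrow> ?h \<in> A_space (enat n)"
      using Suc.IH[OF h] by simp
    also have "\<dots> \<longleftrightarrow> F \<in> A_space (enat n)"
      using FA by (intro A_space_ident_mult_iff) (auto simp: disc_algebra_def)
    finally show ?thesis
      using der by (blast intro: differentiableI_vector)
  qed
  \<comment> \<open>In this direction the extension has to be produced first; the order
    \<open>Suc n\<close> is at least 1, so the boundary function is continuously
    differentiable.\<close>
  have "\<exists>F. cont_extension_to_cdisc (deriv f) F \<and> F \<in> disc_algebra"
    if "of_class_C (enat (Suc n)) ?g"
  proof -
    have diff: "\<And>t. ?g differentiable (at t)" and C: "of_class_C (enat n) (real_deriv ?g)"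
      using that by (auto simp: of_class_C_Suc)
    have "continuous_on UNIV (real_deriv ?g)"
      using C[unfolded of_class_C_def, THEN conjunct2, rule_format, of 0] by simp
    then obtain F where F: "cont_extension_to_cdisc (deriv f) F"
      using extendable_deriv_if_C1_boundary[OF Suc.prems diff] by blast
    have "deriv f holomorphic_on ball 0 1"
      using Suc.prems by (intro holomorphic_deriv) (auto simp: disc_algebra_def)
    then have "F holomorphic_on ball 0 1"
      by (rule holomorphic_transform) (use F in \<open>auto simp: cont_extension_to_cdisc_def\<close>)
    with F show ?thesis
      by (auto simp: disc_algebra_def cont_extension_to_cdisc_def)
  qed
  then show ?case
    unfolding A_space_Suc[OF Suc.prems] using * of_class_C_Suc by blast
qed

theorem theorem2p2:
  fixes p :: enat and f :: "complex \<Rightarrow> complex" and g :: "real \<Rightarrow> complex"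
  assumes "f \<in> disc_algebra"
    and "\<And>t. g t = f (exp (\<i> * complex_of_real t))"
  shows "(f \<in> A_space p \<longleftrightarrow> g \<in> C_circle p) \<and>
    (f \<in> A_space p \<and> 1 \<le> p \<longrightarrow>
      (\<exists>F. cont_extension_to_cdisc (deriv f) F) \<and>
      (\<forall>F. cont_extension_to_cdisc (deriv f) F \<longrightarrow>
        (\<forall>t. (g has_vector_derivative
                \<i> * exp (\<i> * complex_of_real t) * F (exp (\<i> * complex_of_real t))) (at t))))"
proof -
  have g: "g = (\<lambda>t. f (exp (\<i> * complex_of_real t)))"
    using assms(2) by blast
  have "exp (\<i> * complex_of_real (t + 2 * pi)) = exp (\<i> * complex_of_real t)" for t
    using exp_plus_2pin[of "\<i> * complex_of_real t" 1] by (simp add: algebra_simps)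
  then have "g (t + 2 * pi) = g t" for t
    by (simp only: g)
  \<comment> \<open>Both sides are conjunctions over the finite orders up to \<open>p\<close>, so
    the case of infinite \<open>p\<close> is covered as well.\<close>
  moreover have "f \<in> A_space p \<longleftrightarrow> of_class_C p g"
    unfolding g A_space_iff_enat[of f p] of_class_C_iff_enat[of p]
    using A_space_iff_of_class_C_enat[OF assms(1)] by blast
  ultimately have "f \<in> A_space p \<longleftrightarrow> g \<in> C_circle p"
    by (auto simp: C_circle_def)
  moreover have "extendable (deriv f)" if "f \<in> A_space p" "1 \<le> p"
  proof -
    have "enat 1 \<le> p"
      using that(2) by (simp add: one_enat_def)
    then have "extendable ((deriv ^^ 1) f)"
      using that(1) unfolding A_space_def by blast
    then show ?thesis
      by simp
  qed
  ultimately show ?thesis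
    unfolding g using has_vector_derivative_boundary[OF assms(1)] by blast
qed

end
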